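(* Let $1\le p<\infty$, let $w_1\ge w_2\ge\cdots\ge0$, let $A=(a_{j,k})_{j,k\ge1}$ be a matrix with $a_{j,k}\ge0$ for all $j,k$, and let $(E,\|\cdot\|_E)$ be a normed Riesz space of real sequences with property $(PS)$. Assume that for every $n\ge1$ and every $B=(b_{j,k})\in\bigcup_{0\le\gamma\le\lambda\le n+1}\mathcal R_{A_n}^{\gamma,\lambda}$ there exists $C=(c_{j,k})\in\mathcal R_{A_n}$ (depending on $n$ and $B$) with $$\sum_{j=1}^l\sum_{k=1}^r c_{j,k}\ \ge\ \sum_{j=1}^l\sum_{k\in N_r} b_{j,k}$$ for all $1\le l\le n$, all $r\ge1$ and all sets $N_r$ of positive integers with $|N_r|=r$. Then $\|Ax^*\|_{\ell_p(w)}\ge\|Ax\|_{\ell_p(w)}$ for all $x\in E$ with $x\ge0$. Hence decreasing, non-negative elements of $E$ suffice to determine the norm of $A$, i.e. $\|A\|_{E,\ell_p(w)}=\|A\|_{E,\ell_p(w),\downarrow}$.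
   Context: Decreasing means non-increasing; $x\ge0$ means $x_k\ge0$ for all $k$. For a real sequence $x$, $x^*$ denotes the decreasing rearrangement of $\{|x_k|\}$: $x_n^*$ is the $n$-th largest of the numbers $|x_k|$ counted with multiplicity, i.e. $x_n^*=\max_{|N|=n}\min_{k\in N}|x_k|$ over sets $N$ of $n$ indices; $x^*$ exists if all these maxima exist. A normed Riesz space of real sequences is a vector space of real sequences that is a vector lattice under the coordinatewise order and operations, with a norm such that $|x|\le|y|$ coordinatewise implies $\|x\|\le\|y\|$. Such a space $E$ has property $(PS)$ if for every $x\in E$ the sequence $x^*$ exists, and whenever $y$ is a real sequence for which $y^*$ exists and $y_1^*+\cdots+y_n^*\le x_1^*+\cdots+x_n^*$ for all $n\ge1$, then $y\in E$ and $\|y\|_E\le\|x\|_E$. $\|y\|_{\ell_p(w)}=\left(\sum_{k=1}^\infty|y_k|^pw_k\right)^{1/p}$. For $x\ge0$, $(Ax)_j=\sum_{k=1}^\infty a_{j,k}x_k\in[0,\infty]$ and $\|Ax\|_{\ell_p(w)}\in[0,\infty]$, with $0\cdot\infty=0$. Since $A\ge0$, its norm is determined by non-negative sequences: $\|A\|_{E,\ell_p(w)}=\sup\{\|Ax\|_{\ell_p(w)}:\|x\|_E=1,\ x\ge0\}$; and $\|A\|_{E,\ell_p(w),\downarrow}$ is the same supremum restricted to decreasing $x$ (both possibly $\infty$). $A_n$ is the $n\times\infty$ matrix formed by the first $n$ rows of $A$. For an $n\times\infty$ matrix $D$, $\mathcal R_D$ is the set of all matrices obtained from $D$ by permuting its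 rows. For integers $0\le\gamma\le\lambda\le n+1$, $\mathcal R_D^{\gamma,\lambda}$ is the set of $B=(b_{j,k})\in\mathcal R_D$ such that (row indices ranging over $1,\dots,n$, and inequalities in (i), (ii) holding for all $k\ge 1$): (i) $b_{j,k}\ge b_{j+1,k}$ whenever $1\le j\le n-1$ and ($j\le\gamma$ or $j\ge\lambda$); (ii) $b_{r_1,k}\ge b_{j,k}$ whenever $r_1\le\gamma<j<\lambda$, and $b_{j,k}\ge b_{r_2,k}$ whenever $\gamma<j<\lambda\le r_2$; (iii) there is no $\alpha$ with $\gamma<\alpha<\lambda$ such that either $b_{\alpha,k}\ge b_{j,k}$ for all $\gamma<j<\lambda$ and all $k$, or $b_{\alpha,k}\le b_{j,k}$ for all $\gamma<j<\lambda$ and all $k$. *)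

theory Defs
  imports "HOL-Analysis.Analysis"
begin

text \<open>
  All sequences and matrices are indexed from 0: the mathematical entries \<open>x\<^sub>k\<close> and
  \<open>a\<^sub>j\<^sub>,\<^sub>k\<close> (with \<open>j, k \<ge> 1\<close>) are \<open>x (k - 1)\<close> and \<open>a (j - 1) (k - 1)\<close>.
\<close>

section \<open>Decreasing rearrangement\<close>

definition abs_mins :: "(nat \<Rightarrow> real) \<Rightarrow> nat \<Rightarrow> real set" where
  "abs_mins x n = {Min ((\<lambda>k. \<bar>x k\<bar>) ` N) | N. finite N \<and> card N = n}"

definition rearr_exists :: "(nat \<Rightarrow> real) \<Rightarrow> bool" where
  "rearr_exists x \<longleftrightarrow> (\<forall>n\<ge>1. \<exists>m\<in>abs_mins x n. \<forall>m'\<in>abs_mins x n. m' \<le> m)"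

text \<open>
  \<open>rearr x n\<close> is the maximum over sets of \<open>n + 1\<close> indices, because of the index shift; it is
  meaningful only if \<open>rearr_exists x\<close>. (\<open>Max\<close> is not usable, since \<open>abs_mins x n\<close> may be infinite.)
\<close>

definition rearr :: "(nat \<Rightarrow> real) \<Rightarrow> nat \<Rightarrow> real" where
  "rearr x n = (GREATEST m. m \<in> abs_mins x (Suc n))"

section \<open>Normed Riesz spaces of sequences\<close>

text \<open>\<open>sup\<close>, \<open>inf\<close> and \<open>\<le>\<close> on \<open>nat \<Rightarrow> real\<close> are the coordinatewise ones.\<close>

locale normed_riesz_seq_space =
  fixes E :: "(nat \<Rightarrow> real) set" and N :: "(nat \<Rightarrow> real) \<Rightarrow> real"
  assumes zero_mem: "(\<lambda>k. 0) \<in> E"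
    and add_mem: "\<And>x y. x \<in> E \<Longrightarrow> y \<in> E \<Longrightarrow> (\<lambda>k. x k + y k) \<in> E"
    and scale_mem: "\<And>c x. x \<in> E \<Longrightarrow> (\<lambda>k. c * x k) \<in> E"
    and sup_mem: "\<And>x y. x \<in> E \<Longrightarrow> y \<in> E \<Longrightarrow> sup x y \<in> E"
    and inf_mem: "\<And>x y. x \<in> E \<Longrightarrow> y \<in> E \<Longrightarrow> inf x y \<in> E"
    and norm_nonneg: "\<And>x. x \<in> E \<Longrightarrow> 0 \<le> N x"
    and norm_eq_0_iff: "\<And>x. x \<in> E \<Longrightarrow> N x = 0 \<longleftrightarrow> x = (\<lambda>k. 0)"
    and norm_scale: "\<And>c x. x \<in> E \<Longrightarrow> N (\<lambda>k. c * x k) = \<bar>c\<bar> * N x"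
    and norm_triangle: "\<And>x y. x \<in> E \<Longrightarrow> y \<in> E \<Longrightarrow> N (\<lambda>k. x k + y k) \<le> N x + N y"
    and norm_mono: "\<And>x y. x \<in> E \<Longrightarrow> y \<in> E \<Longrightarrow> (\<And>k. \<bar>x k\<bar> \<le> \<bar>y k\<bar>) \<Longrightarrow> N x \<le> N y"

definition property_PS :: "(nat \<Rightarrow> real) set \<Rightarrow> ((nat \<Rightarrow> real) \<Rightarrow> real) \<Rightarrow> bool" where
  "property_PS E N \<longleftrightarrow>
     (\<forall>x\<in>E. rearr_exists x \<and>
        (\<forall>y. rearr_exists y \<and> (\<forall>n\<ge>1. (\<Sum>i<n. rearr y i) \<le> (\<Sum>i<n. rearr x i)) \<longrightarrow>
             y \<in> E \<and> N y \<le> N x))"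

section \<open>Weighted norms and matrix norms with values in $[0,\infty]$\<close>

definition ennpowr :: "ennreal \<Rightarrow> real \<Rightarrow> ennreal" where
  "ennpowr z p = (if z = \<infinity> then \<infinity> else ennreal (enn2real z powr p))"

text \<open>Multiplication on \<^typ>\<open>ennreal\<close> satisfies \<open>0 * \<infinity> = 0\<close>.\<close>

definition lpw_norm :: "real \<Rightarrow> (nat \<Rightarrow> real) \<Rightarrow> (nat \<Rightarrow> ennreal) \<Rightarrow> ennreal" where
  "lpw_norm p w y = ennpowr (\<Sum>k. ennpowr (y k) p * ennreal (w k)) (1 / p)"

text \<open>Only meant for \<open>x \<ge> 0\<close> and \<open>a \<ge> 0\<close>, as \<open>ennreal\<close> sends negative numbers to 0.\<close>

definition mat_app :: "(nat \<Rightarrow> nat \<Rightarrow> real) \<Rightarrow> (nat \<Rightarrow> real) \<Rightarrow> nat \<Rightarrow> ennreal" where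
  "mat_app a x j = (\<Sum>k. ennreal (a j k * x k))"

definition mat_norm ::
  "(nat \<Rightarrow> nat \<Rightarrow> real) \<Rightarrow> (nat \<Rightarrow> real) set \<Rightarrow> ((nat \<Rightarrow> real) \<Rightarrow> real) \<Rightarrow> real \<Rightarrow> (nat \<Rightarrow> real) \<Rightarrow> ennreal"
  where
  "mat_norm a E N p w = (SUP x\<in>{x\<in>E. N x = 1 \<and> (\<forall>k. 0 \<le> x k)}. lpw_norm p w (mat_app a x))"

definition mat_norm_dec ::
  "(nat \<Rightarrow> nat \<Rightarrow> real) \<Rightarrow> (nat \<Rightarrow> real) set \<Rightarrow> ((nat \<Rightarrow> real) \<Rightarrow> real) \<Rightarrow> real \<Rightarrow> (nat \<Rightarrow> real) \<Rightarrow> ennreal"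
  where
  "mat_norm_dec a E N p w =
     (SUP x\<in>{x\<in>E. N x = 1 \<and> (\<forall>k. 0 \<le> x k) \<and> decseq x}. lpw_norm p w (mat_app a x))"

section \<open>Row permutations\<close>

text \<open>An $n\times\infty$ matrix is a function whose rows with index \<open>\<ge> n\<close> are zero.\<close>

definition first_rows :: "nat \<Rightarrow> (nat \<Rightarrow> nat \<Rightarrow> real) \<Rightarrow> nat \<Rightarrow> nat \<Rightarrow> real" where
  "first_rows n a = (\<lambda>j k. if j < n then a j k else 0)"

definition row_perms :: "nat \<Rightarrow> (nat \<Rightarrow> nat \<Rightarrow> real) \<Rightarrow> (nat \<Rightarrow> nat \<Rightarrow> real) set" where
  "row_perms n D = {\<lambda>j. D (\<pi> j) | \<pi>. \<pi> permutes {..<n}}"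

text \<open>
  The set $\mathcal{R}_D^{\gamma,\lambda}$. The bounds \<open>g\<close> ($= \gamma$) and \<open>h\<close> ($= \lambda$) refer to
  1-based row numbers, so the row stored at index \<open>j\<close> is compared with them as \<open>Suc j\<close>.
\<close>

definition row_perms_between ::
  "nat \<Rightarrow> (nat \<Rightarrow> nat \<Rightarrow> real) \<Rightarrow> nat \<Rightarrow> nat \<Rightarrow> (nat \<Rightarrow> nat \<Rightarrow> real) set" where
  "row_perms_between n D g h = {B \<in> row_perms n D.
     (\<forall>j. Suc j < n \<and> (Suc j \<le> g \<or> h \<le> Suc j) \<longrightarrow> (\<forall>k. B (Suc j) k \<le> B j k)) \<and>
     (\<forall>r<n. \<forall>j<n. Suc r \<le> g \<and> g < Suc j \<and> Suc j < h \<longrightarrow> (\<forall>k. B j k \<le> B r k)) \<and>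
     (\<forall>r<n. \<forall>j<n. h \<le> Suc r \<and> g < Suc j \<and> Suc j < h \<longrightarrow> (\<forall>k. B r k \<le> B j k)) \<and>
     \<not> (\<exists>i<n. g < Suc i \<and> Suc i < h \<and>
          ((\<forall>j<n. g < Suc j \<and> Suc j < h \<longrightarrow> (\<forall>k. B j k \<le> B i k)) \<or>
           (\<forall>j<n. g < Suc j \<and> Suc j < h \<longrightarrow> (\<forall>k. B i k \<le> B j k))))}"

end

theory Submission
  imports Defs
begin

text \<open>
  Abel summation over the decreasing weights reduces the inequality to constant weights and the first
  \<open>n\<close> rows, and then the order of the rows is irrelevant. Order them so that \<open>A\<^sub>n x\<close> decreases,
  splitting off rows that dominate, or are dominated by, all remaining ones; this gives a matrix \<open>B\<close>
  to which the hypothesis applies. The resulting \<open>C\<close> satisfies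
  \<open>\<Sum>\<^sub>j\<^sub><\<^sub>l (B x)\<^sub>j \<le> \<Sum>\<^sub>j\<^sub><\<^sub>l (C x\<^sup>*)\<^sub>j\<close> for all \<open>l\<close>, by Abel summation over the columns, and since \<open>B x\<close> is
  decreasing the \<open>p\<close>-th powers inherit the inequality by convexity.
\<close>

section \<open>Summation by parts\<close>

text \<open>Summation by parts writes a sum with decreasing weights as a combination of its partial
  sums with non-negative coefficients: the gaps between successive weights and the last weight. The
  gaps are given by existence rather than by subtraction, so that the lemma serves both
  \<open>real\<close> and \<open>ennreal\<close>.\<close>

lemma Abel_sum_mono:
  fixes z v w :: "nat \<Rightarrow> 'a :: {ordered_comm_semiring, comm_semiring_1}"
  assumes w_diff: "\<And>i. Suc i < n \<Longrightarrow> \<exists>d\<ge>0. w i = d + w (Suc i)"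
    and w_nonneg: "\<And>i. i < n \<Longrightarrow> 0 \<le> w i"
    and partial: "\<And>l. l \<le> n \<Longrightarrow> (\<Sum>j<l. z j) \<le> (\<Sum>j<l. v j)"
  shows "(\<Sum>j<n. z j * w j) \<le> (\<Sum>j<n. v j * w j)"
proof (cases n)
  case (Suc m)
  obtain d where d: "\<And>i. i < m \<Longrightarrow> 0 \<le> d i \<and> w i = d i + w (Suc i)"
    using w_diff Suc by (metis Suc_less_eq)
  have Abel: "(\<Sum>j<Suc l. y j * w j) = w l * (\<Sum>j<Suc l. y j) + (\<Sum>i<l. d i * (\<Sum>j<Suc i. y j))"
    if "l \<le> m" for l and y :: "nat \<Rightarrow> 'a"
    using that
  proof (induction l)
    case (Suc l)
    have "w l = d l + w (Suc l)"
      using d Suc.prems by simp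
    then have "(\<Sum>j<Suc l. y j * w j) =
        (d l + w (Suc l)) * (\<Sum>j<Suc l. y j) + (\<Sum>i<l. d i * (\<Sum>j<Suc i. y j))"
      using Suc by simp
    then show ?case
      by (simp only: sum.lessThan_Suc [of _ "Suc l"] sum.lessThan_Suc [of "\<lambda>i. d i * _ i" l])
        (simp add: algebra_simps)
  qed (simp add: mult.commute)
  have "(\<Sum>i<m. d i * (\<Sum>j<Suc i. z j)) \<le> (\<Sum>i<m. d i * (\<Sum>j<Suc i. v j))"
  proof (rule sum_mono)
    fix i assume "i \<in> {..<m}"
    then show "d i * (\<Sum>j<Suc i. z j) \<le> d i * (\<Sum>j<Suc i. v j)"
      using d partial[of "Suc i"] Suc by (intro mult_left_mono) simp_all
  qed
  moreover have "w m * (\<Sum>j<Suc m. z j) \<le> w m * (\<Sum>j<Suc m. v j)"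
    using w_nonneg partial[of "Suc m"] Suc by (intro mult_left_mono) simp_all
  ultimately show ?thesis
    by (simp only: Suc Abel[OF order_refl, of z] Abel[OF order_refl, of v] add_mono)
qed simp

section \<open>Ordering the rows of a matrix\<close>

lemma obtain_decreasing_list:
  fixes u :: "'a \<Rightarrow> 'b :: linorder"
  assumes "finite I"
  obtains L where "set L = I" "distinct L" "sorted_wrt (\<lambda>i j. u j \<le> u i) L"
proof -
  obtain L where L: "set L = I" "distinct L"
    using finite_distinct_list assms by blast
  have "sorted_wrt (\<lambda>i j. u j \<le> u i) (rev (sort_key u L))"
    using sorted_sort_key[of u L] by (simp add: sorted_wrt_rev sorted_wrt_map)
  with L that[of "rev (sort_key u L)"] show ?thesis
    by simp
qed

text \<open>Peel off indices one at a time: one whose \<open>D\<close> dominates all the others goes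
  to the front of \<open>xs\<close>, one dominated by all the others goes to the end of
  \<open>ys\<close>. When neither exists, the remaining indices, sorted by \<open>u\<close>, form
  \<open>ms\<close>. By \<open>mono\<close>, each peeled index also has an extreme value of
  \<open>u\<close>, so the whole list is sorted by \<open>u\<close>.\<close>

lemma obtain_chain_decomposition:
  fixes D :: "'a \<Rightarrow> 'b :: order" and u :: "'a \<Rightarrow> 'c :: linorder"
  assumes "finite I" and mono: "\<And>i j. D j \<le> D i \<Longrightarrow> u j \<le> u i"
  obtains xs ms ys where "set (xs @ ms @ ys) = I" "distinct (xs @ ms @ ys)"
    "sorted_wrt (\<lambda>i j. u j \<le> u i) (xs @ ms @ ys)"
    "sorted_wrt (\<lambda>i j. D j \<le> D i) xs" "sorted_wrt (\<lambda>i j. D j \<le> D i) ys"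
    "\<forall>i\<in>set xs. \<forall>j\<in>set ms \<union> set ys. D j \<le> D i"
    "\<forall>i\<in>set ms. \<forall>j\<in>set ys. D j \<le> D i"
    "\<not> (\<exists>i\<in>set ms. (\<forall>j\<in>set ms. D j \<le> D i) \<or> (\<forall>j\<in>set ms. D i \<le> D j))"
proof -
  define no_extremum where
    "no_extremum S \<longleftrightarrow> \<not> (\<exists>i\<in>S. (\<forall>j\<in>S. D j \<le> D i) \<or> (\<forall>j\<in>S. D i \<le> D j))" for S
  have "\<exists>xs ms ys. set (xs @ ms @ ys) = I \<and> distinct (xs @ ms @ ys) \<and>
    sorted_wrt (\<lambda>i j. u j \<le> u i) (xs @ ms @ ys) \<and>
    sorted_wrt (\<lambda>i j. D j \<le> D i) xs \<and> sorted_wrt (\<lambda>i j. D j \<le> D i) ys \<and>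
    (\<forall>i\<in>set xs. \<forall>j\<in>set ms \<union> set ys. D j \<le> D i) \<and>
    (\<forall>i\<in>set ms. \<forall>j\<in>set ys. D j \<le> D i) \<and>
    no_extremum (set ms)" (is "\<exists>xs ms ys. ?P I xs ms ys")
    using \<open>finite I\<close>
  proof (induction I rule: finite_psubset_induct)
    case (psubset I)
    consider (top) i where "i \<in> I" "\<forall>j\<in>I. D j \<le> D i"
      | (bot) i where "i \<in> I" "\<forall>j\<in>I. D i \<le> D j"
      | (neither) "no_extremum I"
      unfolding no_extremum_def by blast
    then show ?case
    proof cases
      case top
      then obtain I' where I': "I = insert i I'" "i \<notin> I'"
        by (metis mk_disjoint_insert)
      then have "I' \<subset> I" and dom: "\<forall>j\<in>I'. D j \<le> D i \<and> u j \<le> u i"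
        using top mono by auto
      from psubset.IH[OF this(1)] obtain xs ms ys where P: "?P I' xs ms ys"
        by (elim exE)
      have "?P I (i # xs) ms ys"
        unfolding I'(1) using P I'(2) dom by (elim conjE, intro conjI) auto
      then show ?thesis by (intro exI)
    next
      case bot
      then obtain I' where I': "I = insert i I'" "i \<notin> I'"
        by (metis mk_disjoint_insert)
      then have "I' \<subset> I" and dom: "\<forall>j\<in>I'. D i \<le> D j \<and> u i \<le> u j"
        using bot mono by auto
      from psubset.IH[OF this(1)] obtain xs ms ys where P: "?P I' xs ms ys"
        by (elim exE)
      have "?P I xs ms (ys @ [i])"
        unfolding I'(1) using P I'(2) dom by (elim conjE, intro conjI) (auto simp: sorted_wrt_append)
      then show ?thesis by (intro exI)
    next
      case neither
      obtain L where "set L = I" "distinct L" "sorted_wrt (\<lambda>i j. u j \<le> u i) L"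
        using obtain_decreasing_list psubset.hyps by blast
      with neither have "?P I [] L []"
        by simp
      then show ?thesis by (intro exI)
    qed
  qed
  then show ?thesis
    unfolding no_extremum_def by (elim exE conjE) (rule that)
qed

text \<open>Listing the rows along \<open>xs @ ms @ ys\<close> turns the properties of the three
  blocks into conditions (i), (ii), (iii). In the application \<open>u\<close> is the vector of row
  values at \<open>x\<close>.\<close>

lemma obtain_row_perm_between:
  fixes D :: "nat \<Rightarrow> nat \<Rightarrow> real" and u :: "nat \<Rightarrow> 'c :: linorder"
  assumes mono: "\<And>i j. D j \<le> D i \<Longrightarrow> u j \<le> u i"
  obtains \<pi> g h where "\<pi> permutes {..<n}" "g \<le> h" "h \<le> n + 1"
    "(\<lambda>j. D (\<pi> j)) \<in> row_perms_between n D g h"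
    "\<And>i j. i \<le> j \<Longrightarrow> j < n \<Longrightarrow> u (\<pi> j) \<le> u (\<pi> i)"
proof -
  obtain xs ms ys where set: "set (xs @ ms @ ys) = {..<n}" and distinct: "distinct (xs @ ms @ ys)"
    and sorted: "sorted_wrt (\<lambda>i j. u j \<le> u i) (xs @ ms @ ys)"
    and xs: "sorted_wrt (\<lambda>i j. D j \<le> D i) xs" and ys: "sorted_wrt (\<lambda>i j. D j \<le> D i) ys"
    and above: "\<forall>i\<in>set xs. \<forall>j\<in>set ms \<union> set ys. D j \<le> D i"
    and below: "\<forall>i\<in>set ms. \<forall>j\<in>set ys. D j \<le> D i"
    and mid: "\<not> (\<exists>i\<in>set ms. (\<forall>j\<in>set ms. D j \<le> D i) \<or> (\<forall>j\<in>set ms. D i \<le> D j))"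
    by (rule obtain_chain_decomposition[where D = D and u = u, OF finite_lessThan]) (rule mono, assumption)
  define L where "L = xs @ ms @ ys"
  define g where "g = length xs"
  \<comment> \<open>Conditions on rows use 1-based numbers: \<open>h\<close> is the number of the
    first row of \<open>ys\<close>, or \<open>n + 1\<close> if \<open>ys\<close> is empty, so the
    rows of \<open>ms\<close> are those strictly between \<open>g\<close> and
    \<open>h\<close>.\<close>
  define h where "h = Suc (length xs + length ms)"
  define \<pi> where "\<pi> j = (if j < n then L ! j else j)" for j
  have len: "length L = n"
    using distinct_card[OF distinct, unfolded set] by (simp add: L_def)
  have bij: "bij_betw ((!) L) {..<n} {..<n}"
    using set distinct len by (intro bij_betw_nth) (simp_all only: L_def)
  have perm: "\<pi> permutes {..<n}"
  proof (rule bij_imp_permutes)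
    show "bij_betw \<pi> {..<n} {..<n}"
      using bij by (rule iffD1[OF bij_betw_cong, rotated]) (simp add: \<pi>_def)
  qed (simp add: \<pi>_def)
  have top_mem: "\<pi> j \<in> set xs" if "j < g" for j
    using that len by (auto simp: \<pi>_def L_def g_def nth_append)
  have mid_mem: "\<pi> j \<in> set ms" if "g < Suc j" "Suc j < h" for j
    using that len by (auto simp: \<pi>_def L_def g_def h_def nth_append)
  have bot_mem: "\<pi> j \<in> set ys" if "h \<le> Suc j" "j < n" for j
    using that len by (auto simp: \<pi>_def L_def g_def h_def nth_append)
  have all_mid: "\<exists>j<n. g < Suc j \<and> Suc j < h \<and> \<pi> j = i" if "i \<in> set ms" for i
  proof -
    obtain q where "q < length ms" "ms ! q = i"
      using \<open>i \<in> set ms\<close> by (auto simp: in_set_conv_nth)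
    with len show ?thesis
      by (intro exI[of _ "length xs + q"]) (auto simp: \<pi>_def L_def g_def h_def nth_append)
  qed
  have adjacent: "D (\<pi> (Suc j)) \<le> D (\<pi> j)" if "Suc j < n" "Suc j \<le> g \<or> h \<le> Suc j" for j
  \<comment> \<open>In the first case both rows lie in \<open>xs\<close> or both in
    \<open>ys\<close>. Otherwise \<open>Suc j = g\<close>: row \<open>j\<close> is the last of
    \<open>xs\<close>, and its successor, in \<open>ms\<close> or \<open>ys\<close>, is dominated by
    it.\<close>
  proof (cases "Suc j < g \<or> h \<le> Suc j")
    case True
    then show ?thesis
      using that len xs ys
      by (auto simp: \<pi>_def L_def g_def h_def nth_append sorted_wrt_iff_nth_less Suc_diff_le)
  next
    case False
    with that have "j < g" and "\<not> Suc j < g"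
      by auto
    then show ?thesis
      using top_mem[of j] mid_mem[of "Suc j"] bot_mem[of "Suc j"] above that(1)
      by (cases "Suc (Suc j) < h") auto
  qed
  have mid': False if "i < n" "g < Suc i" "Suc i < h"
    "(\<forall>j<n. g < Suc j \<and> Suc j < h \<longrightarrow> D (\<pi> j) \<le> D (\<pi> i)) \<or>
     (\<forall>j<n. g < Suc j \<and> Suc j < h \<longrightarrow> D (\<pi> i) \<le> D (\<pi> j))" for i
    using that mid mid_mem[of i] all_mid by metis
  show ?thesis
  proof
    show "g \<le> h" "h \<le> n + 1"
      using len by (auto simp: g_def h_def L_def)
    show "(\<lambda>j. D (\<pi> j)) \<in> row_perms_between n D g h"
      unfolding row_perms_between_def mem_Collect_eq
    proof (intro conjI allI impI notI)
      show "(\<lambda>j. D (\<pi> j)) \<in> row_perms n D"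
        using perm by (auto simp: row_perms_def)
    next
      fix j k assume "Suc j < n \<and> (Suc j \<le> g \<or> h \<le> Suc j)"
      then show "D (\<pi> (Suc j)) k \<le> D (\<pi> j) k"
        using adjacent by (auto dest: le_funD)
    next
      fix r j k assume "Suc r \<le> g \<and> g < Suc j \<and> Suc j < h"
      then show "D (\<pi> j) k \<le> D (\<pi> r) k"
        using above top_mem[of r] mid_mem[of j] by (auto dest: le_funD)
    next
      fix r j k assume "r < n" "h \<le> Suc r \<and> g < Suc j \<and> Suc j < h"
      then show "D (\<pi> r) k \<le> D (\<pi> j) k"
        using below bot_mem[of r] mid_mem[of j] by (auto dest: le_funD)
    next
      assume "\<exists>i<n. g < Suc i \<and> Suc i < h \<and>
        ((\<forall>j<n. g < Suc j \<and> Suc j < h \<longrightarrow> (\<forall>k. D (\<pi> j) k \<le> D (\<pi> i) k)) \<or>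
         (\<forall>j<n. g < Suc j \<and> Suc j < h \<longrightarrow> (\<forall>k. D (\<pi> i) k \<le> D (\<pi> j) k)))"
      then show False
        using mid' unfolding le_fun_def by blast
    qed
    show "u (\<pi> j) \<le> u (\<pi> i)" if "i \<le> j" "j < n" for i j
      using that sorted len
      by (cases "i = j") (auto simp: \<pi>_def L_def sorted_wrt_iff_nth_less)
  qed (fact perm)
qed

section \<open>Decreasing rearrangements\<close>

lemma rearr_mem: "rearr_exists x \<Longrightarrow> rearr x n \<in> abs_mins x (Suc n)"
  and rearr_upper: "rearr_exists x \<Longrightarrow> m \<in> abs_mins x (Suc n) \<Longrightarrow> m \<le> rearr x n"
proof -
  have "rearr x n \<in> abs_mins x (Suc n) \<and> (\<forall>m\<in>abs_mins x (Suc n). m \<le> rearr x n)" if ex: "rearr_exists x"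
  proof -
    obtain M where "M \<in> abs_mins x (Suc n)" "\<forall>m\<in>abs_mins x (Suc n). m \<le> M"
      using ex unfolding rearr_exists_def by (metis le_add1 plus_1_eq_Suc)
    moreover from this have "rearr x n = M"
      unfolding rearr_def by (intro Greatest_equality) auto
    ultimately show ?thesis by simp
  qed
  then show "rearr_exists x \<Longrightarrow> rearr x n \<in> abs_mins x (Suc n)"
    "rearr_exists x \<Longrightarrow> m \<in> abs_mins x (Suc n) \<Longrightarrow> m \<le> rearr x n"
    by auto
qed

lemma rearr_nonneg:
  assumes "rearr_exists x"
  shows "0 \<le> rearr x n"
proof -
  obtain S where "finite S" "card S = Suc n" "rearr x n = Min ((\<lambda>k. \<bar>x k\<bar>) ` S)"
    using rearr_mem[OF assms, of n] by (auto simp: abs_mins_def)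
  moreover from this have "S \<noteq> {}"
    by auto
  ultimately show ?thesis
    by simp
qed

text \<open>Dropping one index from a set that attains the maximum cannot lower the minimum over
  it.\<close>

lemma rearr_decseq:
  assumes "rearr_exists x"
  shows "decseq (rearr x)"
proof (rule decseq_SucI)
  fix n
  obtain S where S: "finite S" "card S = Suc (Suc n)" "rearr x (Suc n) = Min ((\<lambda>k. \<bar>x k\<bar>) ` S)"
    using rearr_mem[OF assms, of "Suc n"] by (auto simp: abs_mins_def)
  obtain i where "i \<in> S"
    using S by fastforce
  with S have T: "finite (S - {i})" "card (S - {i}) = Suc n"
    by simp_all
  then have "S - {i} \<noteq> {}"
    by force
  with S have "rearr x (Suc n) \<le> Min ((\<lambda>k. \<bar>x k\<bar>) ` (S - {i}))"
    by (simp only: S(3)) (intro Min_antimono, auto)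
  also have "\<dots> \<le> rearr x n"
    using T by (intro rearr_upper[OF assms]) (auto simp: abs_mins_def)
  finally show "rearr x (Suc n) \<le> rearr x n" .
qed

text \<open>The set \<open>{..n}\<close> attains \<open>x n\<close>, and any set of
  \<open>n + 1\<close> indices contains some \<open>k\<close> with \<open>n \<le> k\<close>, so its
  minimum is at most \<open>x n\<close>.\<close>

lemma
  assumes "decseq x" and nonneg: "\<And>k. 0 \<le> x k"
  shows rearr_exists_decseq: "rearr_exists x" and rearr_of_decseq: "rearr x = x"
proof -
  have mem: "x n \<in> abs_mins x (Suc n)" for n
  proof -
    have "Min ((\<lambda>k. \<bar>x k\<bar>) ` {..n}) = x n"
      using assms by (intro Min_eqI) (auto simp: decseq_def)
    then show ?thesis
      unfolding abs_mins_def by (auto intro!: exI[of _ "{..n}"])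
  qed
  have upper: "m \<le> x n" if m: "m \<in> abs_mins x (Suc n)" for m n
  proof -
    obtain S where S: "finite S" "card S = Suc n" "m = Min ((\<lambda>k. \<bar>x k\<bar>) ` S)"
      using m by (auto simp: abs_mins_def)
    have "\<not> S \<subseteq> {..<n}"
      using card_mono[of "{..<n}" S] S by auto
    then obtain k where "k \<in> S" "n \<le> k"
      by (meson lessThan_iff not_less subsetI)
    then have "m \<le> \<bar>x k\<bar>" and "x k \<le> x n"
      using S assms by (auto simp: decseq_def)
    with nonneg[of k] show ?thesis
      by simp
  qed
  show ex: "rearr_exists x"
    unfolding rearr_exists_def using mem upper by (metis Suc_le_D One_nat_def)
  show "rearr x = x"
    unfolding rearr_def using mem upper by (intro ext Greatest_equality) auto
qed

text \<open>The first \<open>i + 1\<close> entries of \<open>L\<close> form a competitor in the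
  maximum defining \<open>rearr x i\<close>.\<close>

lemma decreasing_list_le_rearr:
  assumes "rearr_exists x" and nonneg: "\<And>k. 0 \<le> x k"
    and "distinct L" and sorted: "sorted_wrt (\<lambda>i j. x j \<le> x i) L" and "i < length L"
  shows "x (L ! i) \<le> rearr x i"
proof -
  define S where "S = (!) L ` {..i}"
  have S: "finite S" "card S = Suc i"
    using \<open>distinct L\<close> \<open>i < length L\<close> unfolding S_def
    by (auto simp: card_image inj_on_def nth_eq_iff_index_eq)
  have "x (L ! i) \<le> x (L ! j)" if "j \<le> i" for j
    using that sorted \<open>i < length L\<close> by (cases "j = i") (auto simp: sorted_wrt_iff_nth_less)
  then have "x (L ! i) \<le> Min ((\<lambda>k. \<bar>x k\<bar>) ` S)"
    using nonneg by (intro Min.boundedI) (auto simp: S_def)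
  also have "\<dots> \<le> rearr x i"
    using S by (intro rearr_upper[OF assms(1)]) (auto simp: abs_mins_def)
  finally show ?thesis .
qed

text \<open>Visit the indices below \<open>n\<close> in an order \<open>L\<close> along which
  \<open>x\<close> decreases. Summation by parts with the weights \<open>x (L ! i)\<close> replaces
  \<open>b\<close> by \<open>c\<close>; afterwards each weight is at most
  \<open>rearr x i\<close>.\<close>

lemma sum_mult_le_sum_mult_rearr:
  fixes b c x :: "nat \<Rightarrow> real"
  assumes "rearr_exists x" and nonneg: "\<And>k. 0 \<le> x k" and "\<And>k. 0 \<le> c k"
    and dom: "\<And>S. finite S \<Longrightarrow> (\<Sum>k\<in>S. b k) \<le> (\<Sum>k<card S. c k)"
  shows "(\<Sum>k<n. b k * x k) \<le> (\<Sum>k<n. c k * rearr x k)"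
proof -
  obtain L where L: "set L = {..<n}" "distinct L" "sorted_wrt (\<lambda>i j. x j \<le> x i) L"
    using obtain_decreasing_list[of "{..<n}" x] by auto
  have len: "length L = n"
    using distinct_card[OF L(2)] L(1) by simp
  have bij: "bij_betw ((!) L) {..<n} {..<n}"
    using L len by (intro bij_betw_nth) simp_all
  have "(\<Sum>k<n. b k * x k) = (\<Sum>i<n. b (L ! i) * x (L ! i))"
    by (rule sum.reindex_bij_betw[OF bij, symmetric])
  also have "\<dots> \<le> (\<Sum>i<n. c i * x (L ! i))"
  proof (rule Abel_sum_mono)
    show "\<exists>d\<ge>0. x (L ! i) = d + x (L ! Suc i)" if "Suc i < n" for i
      using that L(3) len
      by (intro exI[of _ "x (L ! i) - x (L ! Suc i)"]) (simp add: sorted_wrt_iff_nth_less)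
    \<comment> \<open>The first \<open>l\<close> entries of \<open>L\<close> are distinct, so they
      form one of the arbitrary \<open>l\<close>-element sets covered by \<open>dom\<close>.\<close>
    show "(\<Sum>j<l. b (L ! j)) \<le> (\<Sum>j<l. c j)" if "l \<le> n" for l
    proof -
      have inj: "inj_on ((!) L) {..<l}"
        using bij that by (auto simp: bij_betw_def intro: inj_on_subset)
      have "(\<Sum>j<l. b (L ! j)) = (\<Sum>k\<in>(!) L ` {..<l}. b k)"
        by (simp add: sum.reindex[OF inj])
      also have "\<dots> \<le> (\<Sum>j<l. c j)"
        using dom[of "(!) L ` {..<l}"] by (simp add: card_image[OF inj])
      finally show ?thesis .
    qed
  qed (rule nonneg)
  also have "\<dots> \<le> (\<Sum>i<n. c i * rearr x i)"
    using assms(3) decreasing_list_le_rearr[OF assms(1,2) L(2,3)] len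
    by (intro sum_mono mult_left_mono) auto
  finally show ?thesis .
qed

section \<open>Powers and partial sums\<close>

text \<open>The convex function \<open>t powr p\<close> lies above its tangent at \<open>u\<close>.
  For \<open>u = 0\<close> and \<open>p = 1\<close> the convention \<open>0 powr 0 = 0\<close> gives
  slope 0 instead of 1, which is harmless because \<open>v\<close> is non-negative.\<close>

lemma powr_above_tangent:
  fixes u v p :: real
  assumes "1 \<le> p" "0 \<le> u" "0 \<le> v"
  shows "u powr p + p * (v * u powr (p - 1) - u * u powr (p - 1)) \<le> v powr p"
proof -
  have u: "u * u powr (p - 1) = u powr p"
    using \<open>0 \<le> u\<close> by (cases "u = 0") (auto simp: powr_mult_base)
  consider "u = 0" | "v = 0" | "0 < u" "0 < v"
    using assms by fastforce
  then show ?thesis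
  proof cases
    case 2
    have "1 * u powr p \<le> p * u powr p"
      using \<open>1 \<le> p\<close> by (intro mult_right_mono) auto
    with 2 u show ?thesis by simp
  next
    case 3
    \<comment> \<open>Young's inequality for \<open>v powr p\<close> and \<open>u powr p\<close>
      with weights \<open>1 / p\<close> and \<open>1 - 1 / p\<close>; its left side is
      \<open>v * u powr (p - 1)\<close>.\<close>
    have "(v powr p) powr (1 / p) * (u powr p) powr (1 - 1 / p) \<le> 1 / p * v powr p + (1 - 1 / p) * u powr p"
      using assms 3 by (intro Youngs_inequality_0) auto
    moreover have "p * (1 - 1 / p) = p - 1"
      using \<open>1 \<le> p\<close> by (simp add: field_simps)
    ultimately have "v * u powr (p - 1) \<le> 1 / p * v powr p + (1 - 1 / p) * u powr p"
      using assms 3 by (simp add: powr_powr)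
    then have "p * (v * u powr (p - 1)) \<le> p * (1 / p * v powr p + (1 - 1 / p) * u powr p)"
      using \<open>1 \<le> p\<close> by (intro mult_left_mono) auto
    also have "\<dots> = v powr p + (p - 1) * u powr p"
      using \<open>1 \<le> p\<close> by (simp add: field_simps)
    finally show ?thesis
      unfolding u by (simp add: algebra_simps)
  qed simp
qed

text \<open>Bound each \<open>v j powr p\<close> below by the tangent at \<open>u j\<close>. The
  slopes \<open>p * u j powr (p - 1)\<close> decrease with \<open>j\<close>, so summation by parts
  shows that the linear terms have a non-negative sum.\<close>

lemma sum_powr_mono_of_partial_sums:
  fixes u v :: "nat \<Rightarrow> real"
  assumes "1 \<le> p" and u: "\<And>j. j < n \<Longrightarrow> 0 \<le> u j" and v: "\<And>j. j < n \<Longrightarrow> 0 \<le> v j"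
    and antimono: "\<And>i. Suc i < n \<Longrightarrow> u (Suc i) \<le> u i"
    and partial: "\<And>l. l \<le> n \<Longrightarrow> (\<Sum>j<l. u j) \<le> (\<Sum>j<l. v j)"
  shows "(\<Sum>j<n. u j powr p) \<le> (\<Sum>j<n. v j powr p)"
proof -
  let ?d = "\<lambda>j. u j powr (p - 1)"
  have "(\<Sum>j<n. u j * ?d j) \<le> (\<Sum>j<n. v j * ?d j)"
  proof (rule Abel_sum_mono)
    show "\<exists>d\<ge>0. ?d i = d + ?d (Suc i)" if "Suc i < n" for i
      using that antimono u \<open>1 \<le> p\<close>
      by (intro exI[of _ "?d i - ?d (Suc i)"]) (simp add: powr_mono2)
  qed (use partial in auto)
  then have "0 \<le> p * ((\<Sum>j<n. v j * ?d j) - (\<Sum>j<n. u j * ?d j))"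
    using \<open>1 \<le> p\<close> by simp
  then have "(\<Sum>j<n. u j powr p) \<le> (\<Sum>j<n. u j powr p + p * (v j * ?d j - u j * ?d j))"
    by (simp add: sum.distrib sum_distrib_left right_diff_distrib sum_subtractf)
  also have "\<dots> \<le> (\<Sum>j<n. v j powr p)"
    using u v by (intro sum_mono powr_above_tangent[OF \<open>1 \<le> p\<close>]) auto
  finally show ?thesis .
qed

lemma ennpowr_ennreal: "0 \<le> r \<Longrightarrow> ennpowr (ennreal r) p = ennreal (r powr p)"
  by (simp add: ennpowr_def)

lemma ennpowr_mono:
  assumes "y \<le> z" "0 \<le> p"
  shows "ennpowr y p \<le> ennpowr z p"
proof (cases "z = \<infinity>")
  case False
  then have "y \<noteq> \<infinity>" "enn2real y \<le> enn2real z"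
    using assms by (auto simp: enn2real_mono top.not_eq_extremum top_unique)
  with False \<open>0 \<le> p\<close> show ?thesis
    by (auto simp: ennpowr_def intro!: ennreal_leI powr_mono2)
qed (simp add: ennpowr_def)

text \<open>An infinite \<open>v j\<close> makes the right side infinite. Otherwise the bound for
  \<open>l = n\<close> forces every \<open>u j\<close> to be finite as well, and the real case
  applies.\<close>

lemma sum_ennpowr_mono_of_partial_sums:
  fixes u v :: "nat \<Rightarrow> ennreal"
  assumes "1 \<le> p" and antimono: "\<And>i. Suc i < n \<Longrightarrow> u (Suc i) \<le> u i"
    and partial: "\<And>l. l \<le> n \<Longrightarrow> (\<Sum>j<l. u j) \<le> (\<Sum>j<l. v j)"
  shows "(\<Sum>j<n. ennpowr (u j) p) \<le> (\<Sum>j<n. ennpowr (v j) p)"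
proof (cases "\<exists>j<n. v j = \<infinity>")
  case True
  then have "(\<Sum>j<n. ennpowr (v j) p) = \<infinity>"
    by (auto simp: ennpowr_def)
  then show ?thesis
    by (simp only: infinity_ennreal_def top_greatest)
next
  case False
  define u' v' where "u' j = enn2real (u j)" and "v' j = enn2real (v j)" for j
  have v: "v j = ennreal (v' j)" if "j < n" for j
    using False that by (simp add: v'_def top.not_eq_extremum)
  have u: "u j = ennreal (u' j)" if "j < n" for j
  proof -
    have "u j \<le> (\<Sum>i<n. u i)"
      using that by (intro member_le_sum) auto
    also have "\<dots> \<le> (\<Sum>i<n. v i)"
      by (rule partial) simp
    also have "\<dots> < \<infinity>"
      using False by (auto simp: top.not_eq_extremum)
    finally show ?thesis
      by (simp add: u'_def)
  qed
  have nonneg: "0 \<le> u' j" "0 \<le> v' j" for j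
    by (auto simp: u'_def v'_def)
  have "(\<Sum>j<n. u' j powr p) \<le> (\<Sum>j<n. v' j powr p)"
  proof (rule sum_powr_mono_of_partial_sums[OF \<open>1 \<le> p\<close>])
    show "u' (Suc i) \<le> u' i" if "Suc i < n" for i
      using antimono[OF that] u that nonneg by simp
    show "(\<Sum>j<l. u' j) \<le> (\<Sum>j<l. v' j)" if "l \<le> n" for l
      using partial[OF that] u v that nonneg by (simp add: sum_nonneg)
  qed (use nonneg in auto)
  then show ?thesis
    using u v nonneg by (simp add: ennpowr_ennreal ennreal_leI)
qed

section \<open>Matrices applied to sequences\<close>

lemma sum_mat_app:
  assumes "\<And>j k. 0 \<le> b j k" "\<And>k. 0 \<le> x k"
  shows "(\<Sum>j<l. mat_app b x j) = (\<Sum>k. ennreal ((\<Sum>j<l. b j k) * x k))"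
  using assms by (simp add: mat_app_def suminf_sum[OF summableI, symmetric] sum_distrib_right)

text \<open>Adding up the first \<open>l\<close> rows reduces the claim to a single sequence of
  column sums. Each truncation of the left series to \<open>n\<close> columns is bounded by the same
  truncation on the right, hence by the full series there.\<close>

lemma sum_mat_app_le_rearr:
  assumes b: "\<And>j k. 0 \<le> b j k" and c: "\<And>j k. 0 \<le> c j k"
    and x: "\<And>k. 0 \<le> x k" "rearr_exists x"
    and dom: "\<And>S. finite S \<Longrightarrow> (\<Sum>j<l. \<Sum>k\<in>S. b j k) \<le> (\<Sum>j<l. \<Sum>k<card S. c j k)"
  shows "(\<Sum>j<l. mat_app b x j) \<le> (\<Sum>j<l. mat_app c (rearr x) j)"
  unfolding sum_mat_app[OF b x(1)] sum_mat_app[OF c rearr_nonneg[OF x(2)]]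
proof (rule suminf_le_const[OF summableI])
  fix n
  have "(\<Sum>k<n. (\<Sum>j<l. b j k) * x k) \<le> (\<Sum>k<n. (\<Sum>j<l. c j k) * rearr x k)"
  proof (rule sum_mult_le_sum_mult_rearr[OF x(2,1)])
    show "(\<Sum>k\<in>S. \<Sum>j<l. b j k) \<le> (\<Sum>k<card S. \<Sum>j<l. c j k)" if "finite S" for S
      using dom[OF that] by (simp add: sum.swap[of _ S] sum.swap[of _ "{..<card S}"])
  qed (simp add: c sum_nonneg)
  then have "(\<Sum>k<n. ennreal ((\<Sum>j<l. b j k) * x k)) \<le> (\<Sum>k<n. ennreal ((\<Sum>j<l. c j k) * rearr x k))"
    using b c x by (simp add: rearr_nonneg sum_nonneg ennreal_leI)
  also have "\<dots> \<le> (\<Sum>k. ennreal ((\<Sum>j<l. c j k) * rearr x k))"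
    by (rule sum_le_suminf) auto
  finally show "(\<Sum>k<n. ennreal ((\<Sum>j<l. b j k) * x k)) \<le> (\<Sum>k. ennreal ((\<Sum>j<l. c j k) * rearr x k))" .
qed

text \<open>Used with \<open>f\<close> the \<open>p\<close>-th power to return from the permuted
  matrices to \<open>a\<close>: a sum over all \<open>n\<close> rows does not depend on their
  order.\<close>

lemma sum_mat_app_permuted_rows:
  fixes f :: "ennreal \<Rightarrow> 'a :: comm_monoid_add"
  assumes "\<pi> permutes {..<n}"
  shows "(\<Sum>j<n. f (mat_app (\<lambda>j. first_rows n a (\<pi> j)) x j)) = (\<Sum>j<n. f (mat_app a x j))"
proof -
  have "(\<Sum>j<n. f (mat_app (\<lambda>j. first_rows n a (\<pi> j)) x j)) = (\<Sum>j<n. f (mat_app a x (\<pi> j)))"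
    using permutes_in_image[OF assms] by (intro sum.cong) (auto simp: mat_app_def first_rows_def)
  also have "\<dots> = (\<Sum>j<n. f (mat_app a x j))"
    by (rule sum.reindex_bij_betw[OF permutes_imp_bij[OF assms]])
  finally show ?thesis .
qed

text \<open>Here \<open>\<pi>\<close> sorts the rows by their values at \<open>x\<close> and gives
  the matrix \<open>B\<close>, while \<open>\<sigma>\<close> comes from the matrix \<open>C\<close>
  supplied by \<open>dom\<close>.\<close>

lemma sum_ennpowr_mat_app_le_rearr:
  assumes "1 \<le> p" and a: "\<And>j k. 0 \<le> a j k"
    and dom: "\<And>g h B. \<lbrakk>g \<le> h; h \<le> n + 1; B \<in> row_perms_between n (first_rows n a) g h\<rbrakk> \<Longrightarrow>
           \<exists>C \<in> row_perms n (first_rows n a).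
             \<forall>l r S. 1 \<le> l \<and> l \<le> n \<and> 1 \<le> r \<and> finite S \<and> card S = r \<longrightarrow>
               (\<Sum>j<l. \<Sum>k\<in>S. B j k) \<le> (\<Sum>j<l. \<Sum>k<r. C j k)"
    and x: "\<And>k. 0 \<le> x k" "rearr_exists x"
  shows "(\<Sum>j<n. ennpowr (mat_app a x j) p) \<le> (\<Sum>j<n. ennpowr (mat_app a (rearr x) j) p)"
proof -
  let ?D = "first_rows n a"
  have D_nonneg: "0 \<le> ?D j k" for j k
    by (simp add: first_rows_def a)
  have "mat_app ?D x j \<le> mat_app ?D x i" if "?D j \<le> ?D i" for i j
    unfolding mat_app_def using that x
    by (intro suminf_le summableI ennreal_leI mult_right_mono) (auto dest: le_funD)
  then obtain \<pi> g h where \<pi>: "\<pi> permutes {..<n}" "g \<le> h" "h \<le> n + 1"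
    "(\<lambda>j. ?D (\<pi> j)) \<in> row_perms_between n ?D g h"
    and antimono: "\<And>i j. i \<le> j \<Longrightarrow> j < n \<Longrightarrow> mat_app ?D x (\<pi> j) \<le> mat_app ?D x (\<pi> i)"
    using obtain_row_perm_between[of ?D "mat_app ?D x" n] by blast
  from dom[OF \<pi>(2-4)] obtain \<sigma> where \<sigma>: "\<sigma> permutes {..<n}"
    and le: "\<And>l S. 1 \<le> l \<and> l \<le> n \<and> 1 \<le> card S \<and> finite S \<Longrightarrow>
               (\<Sum>j<l. \<Sum>k\<in>S. ?D (\<pi> j) k) \<le> (\<Sum>j<l. \<Sum>k<card S. ?D (\<sigma> j) k)"
    unfolding row_perms_def by blast
  have "(\<Sum>j<n. ennpowr (mat_app (\<lambda>j. ?D (\<pi> j)) x j) p)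
      \<le> (\<Sum>j<n. ennpowr (mat_app (\<lambda>j. ?D (\<sigma> j)) (rearr x) j) p)"
  proof (rule sum_ennpowr_mono_of_partial_sums[OF \<open>1 \<le> p\<close>])
    show "mat_app (\<lambda>j. ?D (\<pi> j)) x (Suc i) \<le> mat_app (\<lambda>j. ?D (\<pi> j)) x i" if "Suc i < n" for i
      using antimono[of i "Suc i"] that by (simp add: mat_app_def)
    show "(\<Sum>j<l. mat_app (\<lambda>j. ?D (\<pi> j)) x j) \<le> (\<Sum>j<l. mat_app (\<lambda>j. ?D (\<sigma> j)) (rearr x) j)"
      if "l \<le> n" for l
    proof (rule sum_mat_app_le_rearr[OF D_nonneg D_nonneg x])
      fix S :: "nat set" assume "finite S"
      with le[of l S] that show "(\<Sum>j<l. \<Sum>k\<in>S. ?D (\<pi> j) k) \<le> (\<Sum>j<l. \<Sum>k<card S. ?D (\<sigma> j) k)"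
        \<comment> \<open>The hypothesis starts at \<open>l = 1\<close> and \<open>r = 1\<close>;
          the remaining sums are empty.\<close>
        by (cases "l = 0"; cases "S = {}") (auto simp: Suc_le_eq card_gt_0_iff)
    qed
  qed
  then show ?thesis
    by (simp only: sum_mat_app_permuted_rows[OF \<pi>(1), of "\<lambda>y. ennpowr y p"]
      sum_mat_app_permuted_rows[OF \<sigma>, of "\<lambda>y. ennpowr y p"])
qed

section \<open>Weighted norms and property (PS)\<close>

text \<open>Summation by parts again, now in \<open>ennreal\<close> and with the weights
  \<open>w\<close>, applied to each partial sum of the series.\<close>

lemma lpw_norm_mono_of_partial_sums:
  assumes "1 \<le> p" and "decseq w" and "\<And>k. 0 \<le> w k"
    and partial: "\<And>n. (\<Sum>j<n. ennpowr (y j) p) \<le> (\<Sum>j<n. ennpowr (z j) p)"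
  shows "lpw_norm p w y \<le> lpw_norm p w z"
  unfolding lpw_norm_def
proof (rule ennpowr_mono)
  show "(\<Sum>k. ennpowr (y k) p * ennreal (w k)) \<le> (\<Sum>k. ennpowr (z k) p * ennreal (w k))"
  proof (rule suminf_le_const[OF summableI])
    fix n
    have "(\<Sum>k<n. ennpowr (y k) p * ennreal (w k)) \<le> (\<Sum>k<n. ennpowr (z k) p * ennreal (w k))"
    proof (rule Abel_sum_mono)
      show "\<exists>d\<ge>0. ennreal (w i) = d + ennreal (w (Suc i))" for i
        using assms(2,3) by (intro exI[of _ "ennreal (w i - w (Suc i))"])
          (simp add: decseq_Suc_iff flip: ennreal_plus)
    qed (simp_all add: partial)
    also have "\<dots> \<le> (\<Sum>k. ennpowr (z k) p * ennreal (w k))"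
      by (rule sum_le_suminf) auto
    finally show "(\<Sum>k<n. ennpowr (y k) p * ennreal (w k)) \<le> (\<Sum>k. ennpowr (z k) p * ennreal (w k))" .
  qed
qed (use \<open>1 \<le> p\<close> in simp)

text \<open>Being decreasing and non-negative, \<open>rearr x\<close> is its own rearrangement. So
  \<open>x\<close> and \<open>rearr x\<close> have equal rearrangements, and property (PS) applies
  in both directions.\<close>

lemma
  assumes "property_PS E N" "x \<in> E"
  shows property_PS_rearr_mem: "rearr x \<in> E" and property_PS_norm_rearr: "N (rearr x) = N x"
proof -
  have PS: "y \<in> E \<and> N y \<le> N x"
    if "x \<in> E" "rearr_exists y" "rearr y = rearr x" for x y
    using assms(1) that unfolding property_PS_def by (metis order_refl)
  have ex: "rearr_exists x"
    using assms by (auto simp: property_PS_def)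
  note dec = rearr_decseq[OF ex] rearr_nonneg[OF ex]
  show "rearr x \<in> E" "N (rearr x) = N x"
    using PS[OF \<open>x \<in> E\<close> rearr_exists_decseq[OF dec] rearr_of_decseq[OF dec]]
      PS[OF _ ex rearr_of_decseq[OF dec, symmetric]] by (auto intro: antisym)
qed

theorem theorem3p3:
  fixes p :: real and w :: "nat \<Rightarrow> real" and a :: "nat \<Rightarrow> nat \<Rightarrow> real"
    and E :: "(nat \<Rightarrow> real) set" and N :: "(nat \<Rightarrow> real) \<Rightarrow> real"
  assumes "1 \<le> p"
    and "decseq w" and "\<And>k. 0 \<le> w k"
    and "\<And>j k. 0 \<le> a j k"
    and "normed_riesz_seq_space E N" and "property_PS E N"
    and "\<And>n g h B. \<lbrakk>1 \<le> n; g \<le> h; h \<le> n + 1; B \<in> row_perms_between n (first_rows n a) g h\<rbrakk> \<Longrightarrow>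
           \<exists>C \<in> row_perms n (first_rows n a).
             \<forall>l r S. 1 \<le> l \<and> l \<le> n \<and> 1 \<le> r \<and> finite S \<and> card S = r \<longrightarrow>
               (\<Sum>j<l. \<Sum>k\<in>S. B j k) \<le> (\<Sum>j<l. \<Sum>k<r. C j k)"
  shows "(\<forall>x\<in>E. (\<forall>k. 0 \<le> x k) \<longrightarrow> lpw_norm p w (mat_app a x) \<le> lpw_norm p w (mat_app a (rearr x)))
    \<and> mat_norm a E N p w = mat_norm_dec a E N p w"
proof -
  have ex: "rearr_exists x" if "x \<in> E" for x
    using assms(6) that by (simp add: property_PS_def)
  have le: "lpw_norm p w (mat_app a x) \<le> lpw_norm p w (mat_app a (rearr x))"
    if "x \<in> E" and nonneg: "\<And>k. 0 \<le> x k" for x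
  proof (rule lpw_norm_mono_of_partial_sums[OF assms(1-3)])
    show "(\<Sum>j<n. ennpowr (mat_app a x j) p) \<le> (\<Sum>j<n. ennpowr (mat_app a (rearr x) j) p)" for n
    proof (cases "n = 0")
      case False
      then have "1 \<le> n" by simp
      show ?thesis
        by (rule sum_ennpowr_mat_app_le_rearr[OF assms(1,4) assms(7)[OF \<open>1 \<le> n\<close>] nonneg ex[OF \<open>x \<in> E\<close>]])
    qed simp
  qed
  have "mat_norm a E N p w \<le> mat_norm_dec a E N p w"
    unfolding mat_norm_def
  proof (rule SUP_least)
    fix x assume x: "x \<in> {x \<in> E. N x = 1 \<and> (\<forall>k. 0 \<le> x k)}"
    then have "lpw_norm p w (mat_app a x) \<le> lpw_norm p w (mat_app a (rearr x))"
      by (intro le) auto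
    \<comment> \<open>\<open>rearr x\<close> competes in the restricted supremum: it lies in
      \<open>E\<close>, has norm 1, and is non-negative and decreasing.\<close>
    also have "\<dots> \<le> mat_norm_dec a E N p w"
      unfolding mat_norm_dec_def using x assms(6) ex
      by (intro SUP_upper) (simp add: property_PS_rearr_mem property_PS_norm_rearr rearr_nonneg rearr_decseq)
    finally show "lpw_norm p w (mat_app a x) \<le> mat_norm_dec a E N p w" .
  qed
  moreover have "mat_norm_dec a E N p w \<le> mat_norm a E N p w"
    unfolding mat_norm_def mat_norm_dec_def by (intro SUP_subset_mono) auto
  ultimately show ?thesis
    using le by (auto intro: antisym)
qed

end
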